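(* For any $n\geq 1$, the polynomial $F_{n+1}(x)$ equals the lower Hessenberg determinant of order $n+1$ $$F_{n+1}(x)=\det(m_{i,j})_{0\leq i,j\leq n},$$ where $m_{0,0}=x$, $m_{i,0}=x\,B_i(x^2)$ for $1\leq i\leq n$, $m_{i,j}=-\binom{i}{j-1}F_{i-j+1}(-x)$ for $1\leq j\leq i\leq n$, $m_{i,i+1}=-1$ for $0\leq i\leq n-1$, and $m_{i,j}=0$ for $j>i+1$.
   Context: The type $B$ Eulerian polynomials are $B_n(x)=\sum_{\sigma\in\mathcal{B}_n}x^{\mathrm{des}_B(\sigma)}$, where $\mathcal{B}_n$ is the hyperoctahedral group of signed permutations of $\{\pm1,\ldots,\pm n\}$ ($\sigma(-i)=-\sigma(i)$) and $\mathrm{des}_B(\sigma)=\#\{i\in\{0,\ldots,n-1\}:\sigma(i)>\sigma(i+1)\}$ with $\sigma(0)=0$. Equivalently $B_0(x)=1$ and $B_{n+1}(x)=(2nx+1+x)B_n(x)+2x(1-x)B_n'(x)$. The alternating run polynomials of dual Stirling permutations $F_n(x)$ are defined by $\left(x\frac{d}{dx}\right)^n r(x)=\frac{r(x)F_n(x)}{(1-x^2)^n}$ with $r(x)=\sqrt{\frac{1+x}{1-x}}$; equivalently $F_0(x)=1$ and $F_{n+1}(x)=(x+2nx^2)F_n(x)+x(1-x^2)F_n'(x)$. E.g. $F_1=x$, $F_2=x+x^2+x^3$, $F_3=x+3x^2+7x^3+3x^4+x^5$. *)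

theory Defs
  imports
    "HOL-Analysis.Derivative"
    "HOL-Combinatorics.Permutations"
    "HOL-Computational_Algebra.Polynomial"
    "Jordan_Normal_Form.Determinant"
begin

(* Fixing every integer outside {-n..n} makes the set finite; the value 0 at 0
   follows from \<sigma> (-i) = - \<sigma> i. *)
definition signed_perms :: "nat \<Rightarrow> (int \<Rightarrow> int) set" where
  "signed_perms n =
     {\<sigma>. \<sigma> permutes {i. 1 \<le> \<bar>i\<bar> \<and> \<bar>i\<bar> \<le> int n} \<and> (\<forall>i. \<sigma> (- i) = - \<sigma> i)}"

definition desB :: "nat \<Rightarrow> (int \<Rightarrow> int) \<Rightarrow> nat" where
  "desB n \<sigma> = card {i \<in> {0..<n}. \<sigma> (int i) > \<sigma> (int i + 1)}"

definition eulerianB :: "nat \<Rightarrow> real poly" where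
  "eulerianB n = (\<Sum>\<sigma>\<in>signed_perms n. monom 1 (desB n \<sigma>))"

definition xD :: "(real \<Rightarrow> real) \<Rightarrow> real \<Rightarrow> real" where
  "xD f = (\<lambda>x. x * deriv f x)"

definition rfun :: "real \<Rightarrow> real" where
  "rfun x = sqrt ((1 + x) / (1 - x))"

definition is_alt_run_poly :: "nat \<Rightarrow> real poly \<Rightarrow> bool" where
  "is_alt_run_poly n p \<longleftrightarrow>
     (\<forall>x\<in>{-1<..<1}. (xD ^^ n) rfun x = rfun x * poly p x / (1 - x\<^sup>2) ^ n)"

definition alt_run_poly :: "nat \<Rightarrow> real poly" where
  "alt_run_poly n = (THE p. is_alt_run_poly n p)"

lemma rfun_pos: "x \<in> {-1<..<1} \<Longrightarrow> rfun x > 0"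
  by (auto simp: rfun_def)

lemma is_alt_run_poly_unique:
  assumes "is_alt_run_poly n p" "is_alt_run_poly n q"
  shows "p = q"
proof -
  have eq: "poly (p - q) x = 0" if x: "x \<in> {-1<..<1}" for x
  proof -
    have "rfun x * poly p x / (1 - x\<^sup>2) ^ n = rfun x * poly q x / (1 - x\<^sup>2) ^ n"
      using assms x by (simp add: is_alt_run_poly_def)
    moreover have "1 - x\<^sup>2 \<noteq> 0"
      using x by (auto simp: power2_eq_1_iff)
    ultimately show ?thesis using rfun_pos[OF x] by simp
  qed
  have "infinite {-1<..<(1::real)}" by (simp add: infinite_Ioo)
  moreover have "{-1<..<(1::real)} \<subseteq> {x. poly (p - q) x = 0}" using eq by blast
  ultimately have "infinite {x. poly (p - q) x = 0}" using finite_subset by blast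
  then show ?thesis using poly_roots_finite[of "p - q"] by auto
qed

lemma rfun_deriv:
  assumes "x \<in> {-1<..<1}"
  shows "(rfun has_real_derivative rfun x / (1 - x\<^sup>2)) (at x)"
proof -
  have pos: "1 + x > 0" "1 - x > 0" using assms by auto
  define s where "s = sqrt ((1 + x) / (1 - x))"
  have s: "s > 0" "s * s = (1 + x) / (1 - x)"
    using pos by (auto simp: s_def)
  have "((\<lambda>x. sqrt ((1 + x) / (1 - x))) has_real_derivative
           (inverse s / 2) * (2 / (1 - x)\<^sup>2)) (at x)"
    unfolding s_def using pos
    by (auto intro!: derivative_eq_intros simp: field_simps power2_eq_square)
  moreover have "(inverse s / 2) * (2 / (1 - x)\<^sup>2) = s / (1 - x\<^sup>2)"
  proof -
    have "inverse s = s / (s * s)" using s(1) by (simp add: field_simps)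
    then have inv: "inverse s = s * (1 - x) / (1 + x)" unfolding s(2) by simp
    then have "(inverse s / 2) * (2 / (1 - x)\<^sup>2) = s / ((1 + x) * (1 - x))"
    proof -
      have "a > 0 \<Longrightarrow> b > 0 \<Longrightarrow> (s * b / a / 2) * (2 / b\<^sup>2) = s / (a * b)" for a b
        by (simp add: field_simps power2_eq_square)
      with pos inv show ?thesis by metis
    qed
    then show ?thesis by (simp add: algebra_simps power2_eq_square)
  qed
  ultimately show ?thesis unfolding rfun_def s_def by simp
qed

lemma is_alt_run_poly_0: "is_alt_run_poly 0 1"
  by (simp add: is_alt_run_poly_def)

lemma is_alt_run_poly_Suc:
  assumes "is_alt_run_poly n p"
  shows "is_alt_run_poly (Suc n)
    ([:0, 1, 2 * of_nat n:] * p + [:0, 1, 0, -1:] * pderiv p)"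
  unfolding is_alt_run_poly_def
proof
  fix x :: real assume x: "x \<in> {-1<..<1}"
  have nz: "1 - x\<^sup>2 \<noteq> 0" using x by (auto simp: power2_eq_1_iff)
  define g where "g = (\<lambda>x. rfun x * (poly p x * inverse (1 - x\<^sup>2) ^ n))"
  let ?u = "inverse (1 - x\<^sup>2)"
  have inv: "((\<lambda>x. inverse (1 - x\<^sup>2)) has_real_derivative 2 * x * ?u\<^sup>2) (at x)"
    using nz by (auto intro!: derivative_eq_intros simp: field_simps power2_eq_square)
  have "((\<lambda>x. inverse (1 - x\<^sup>2) ^ n) has_real_derivative
      of_nat n * (2 * x * ?u\<^sup>2 * ?u ^ (n - 1))) (at x)"
    using DERIV_power[OF inv, of n] by simp
  moreover have "of_nat n * (2 * x * ?u\<^sup>2 * ?u ^ (n - 1)) = 2 * of_nat n * x * ?u ^ Suc n"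
    by (cases n) (simp_all add: power2_eq_square algebra_simps)
  ultimately have pw: "((\<lambda>x. inverse (1 - x\<^sup>2) ^ n) has_real_derivative
      2 * of_nat n * x * ?u ^ Suc n) (at x)" by metis
  let ?D = "rfun x * (poly p x * (2 * of_nat n * x * ?u ^ Suc n) + poly (pderiv p) x * ?u ^ n)
      + rfun x / (1 - x\<^sup>2) * (poly p x * ?u ^ n)"
  have "(g has_real_derivative ?D) (at x)"
    unfolding g_def
    by (rule DERIV_mult'[OF rfun_deriv[OF x] DERIV_mult'[OF poly_DERIV pw]])
  then have "((xD ^^ n) rfun has_real_derivative ?D) (at x)"
    by (rule has_field_derivative_transform_within_open[of _ _ _ "{-1<..<1}"])
       (use assms x in \<open>auto simp: g_def is_alt_run_poly_def field_simps\<close>)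
  then have "(xD ^^ Suc n) rfun x = x * ?D"
    by (simp add: xD_def DERIV_imp_deriv)
  also have "\<dots> = rfun x * ((x + 2 * of_nat n * x\<^sup>2) * poly p x
      + x * (1 - x\<^sup>2) * poly (pderiv p) x) * ?u ^ Suc n"
  proof -
    have "?u ^ n = (1 - x\<^sup>2) * ?u ^ Suc n" using nz by simp
    moreover have "rfun x / (1 - x\<^sup>2) * (poly p x * ?u ^ n) = rfun x * poly p x * ?u ^ Suc n"
      by (simp add: divide_inverse)
    ultimately have "x * ?D = x * (rfun x * (poly p x * (2 * of_nat n * x * ?u ^ Suc n)
        + poly (pderiv p) x * ((1 - x\<^sup>2) * ?u ^ Suc n)) + rfun x * poly p x * ?u ^ Suc n)"
      by metis
    then show ?thesis by (simp only: algebra_simps power2_eq_square)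
  qed
  also have "\<dots> = rfun x * poly ([:0, 1, 2 * of_nat n:] * p + [:0, 1, 0, -1:] * pderiv p) x
      / (1 - x\<^sup>2) ^ Suc n"
  proof -
    have "poly ([:0, 1, 2 * of_nat n:] * p + [:0, 1, 0, -1:] * pderiv p) x =
        (x + 2 * of_nat n * x\<^sup>2) * poly p x + x * (1 - x\<^sup>2) * poly (pderiv p) x"
      by (simp add: algebra_simps power2_eq_square)
    then show ?thesis by (simp only: divide_inverse power_inverse)
  qed
  finally show "(xD ^^ Suc n) rfun x = rfun x *
      poly ([:0, 1, 2 * of_nat n:] * p + [:0, 1, 0, -1:] * pderiv p) x / (1 - x\<^sup>2) ^ Suc n" .
qed

lemma is_alt_run_poly_alt_run_poly: "is_alt_run_poly n (alt_run_poly n)"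
proof -
  have "\<exists>p. is_alt_run_poly n p"
    by (induction n) (blast intro: is_alt_run_poly_0 is_alt_run_poly_Suc)+
  then show ?thesis
    unfolding alt_run_poly_def by (metis is_alt_run_poly_unique theI)
qed

lemma alt_run_poly_0: "alt_run_poly 0 = 1"
  using is_alt_run_poly_unique is_alt_run_poly_alt_run_poly is_alt_run_poly_0 by blast

lemma alt_run_poly_Suc:
  "alt_run_poly (Suc n) =
     [:0, 1, 2 * of_nat n:] * alt_run_poly n + [:0, 1, 0, -1:] * pderiv (alt_run_poly n)"
  using is_alt_run_poly_unique is_alt_run_poly_alt_run_poly is_alt_run_poly_Suc by blast

definition hess_entry :: "nat \<Rightarrow> nat \<Rightarrow> real poly" where
  "hess_entry i j =
     (if j = 0 then
        (if i = 0 then [:0, 1:] else [:0, 1:] * pcompose (eulerianB i) (monom 1 2))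
      else if j \<le> i then
        - of_nat (i choose (j - 1)) * pcompose (alt_run_poly (i - j + 1)) [:0, -1:]
      else if j = i + 1 then - 1
      else 0)"

end

theory Submission
  imports Defs
begin

text \<open>
  Write \<open>D\<close> for \<open>x d/dx\<close> and \<open>r\<close> for \<open>sqrt ((1 + x) / (1 - x))\<close>.  Since
  \<open>r (-x) = 1 / r x\<close> and \<open>D\<close> commutes with the reflection \<open>x \<mapsto> -x\<close>, the polynomials
  \<open>F\<^sub>n (-x)\<close> are for \<open>1 / r\<close> what the \<open>F\<^sub>n (x)\<close> are for \<open>r\<close>.  The product
  \<open>D r \<cdot> (1 / r)\<close> is \<open>x / (1 - x\<^sup>2)\<close>, the sum of the odd powers of \<open>x\<close>, so its image under
  \<open>D\<^sup>n\<close> is the sum of \<open>(2k+1)\<^sup>n x\<^bsup>2k+1\<^esup>\<close>, which is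
  \<open>x B\<^sub>n (x\<^sup>2) / (1 - x\<^sup>2)\<^bsup>n+1\<^esup>\<close>.  Expanding the same image by Leibniz' rule gives the
  convolution identity \<open>alt_run_convolution\<close>,
  \<open>\<Sum>k\<le>n. (n choose k) F\<^sub>k\<^sub>+\<^sub>1 (x) F\<^sub>n\<^sub>-\<^sub>k (-x) = x B\<^sub>n (x\<^sup>2)\<close>.

  The term \<open>k = n\<close> on the left is \<open>F\<^sub>n\<^sub>+\<^sub>1 (x)\<close>.  Solving for it gives a linear recurrence
  for the sequence \<open>1, F\<^sub>1, F\<^sub>2, \<dots>\<close> whose coefficients are the entries of the Hessenberg
  matrix, and \<open>det_lower_hessenberg\<close>, an instance of Cramer's rule, says that such a
  determinant is the next value of the sequence.

  The analytic argument is carried out on numerators: both sides of the convolution identity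
  satisfy the first-order recurrence of the numerator of \<open>D\<^sup>n (x / (1 - x\<^sup>2))\<close>.  For the left
  side this is Leibniz' rule and Pascal's rule.  For the right side it is the recurrence
  \<open>eulerianB_Suc\<close> of the type B Eulerian polynomials, which follows from the combinatorial
  definition by inserting the letter \<open>n+1\<close> or \<open>-(n+1)\<close> at every position of a signed
  permutation of size \<open>n\<close>.
\<close>

section \<open>Lower Hessenberg determinants solve linear recurrences\<close>

text \<open>
  The recurrence says that the matrix maps \<open>(v 0, \<dots>, v n)\<close> to the vector whose only nonzero
  entry is \<open>v (n+1)\<close>, in the last place.  Replacing column 0 by this vector, as in Cramer's
  rule, multiplies the determinant by \<open>v 0 = 1\<close>.  The minor left after expanding along the
  new column is triangular with \<open>-1\<close> on the diagonal, and its sign cancels that of the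
  cofactor.
\<close>
lemma det_lower_hessenberg:
  fixes a :: "nat \<Rightarrow> nat \<Rightarrow> 'a :: comm_ring_1"
  assumes v0: "v 0 = 1"
    and rec: "\<And>i. i \<le> n \<Longrightarrow> v (Suc i) = (\<Sum>j\<le>i. a i j * v j)"
  shows "det (mat (Suc n) (Suc n)
           (\<lambda>(i, j). if j \<le> i then a i j else if j = Suc i then - 1 else 0)) = v (Suc n)"
proof -
  define m where "m = (\<lambda>i j. if j \<le> i then a i j else if j = Suc i then - 1 else (0 :: 'a))"
  define M where "M = mat (Suc n) (Suc n) (\<lambda>(i, j). m i j)"
  define P where "P = mat (Suc n) (Suc n)
    (\<lambda>(i, j). if j = 0 then v i else if i = j then 1 else 0)"
  define Q where "Q = mat (Suc n) (Suc n)
    (\<lambda>(i, j). if j = 0 then if i = n then v (Suc n) else 0 else m i j)"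
  \<comment> \<open>Multiplying by \<open>P\<close> on the right replaces column 0 by the image of \<open>v\<close>.\<close>
  have MC: "M \<in> carrier_mat (Suc n) (Suc n)" and PC: "P \<in> carrier_mat (Suc n) (Suc n)"
    and QC: "Q \<in> carrier_mat (Suc n) (Suc n)"
    by (simp_all add: M_def P_def Q_def)
  have col0: "(\<Sum>k<Suc n. m i k * v k) = (if i = n then v (Suc n) else 0)" if "i \<le> n" for i
  proof (cases "i = n")
    case True
    have "(\<Sum>k<Suc n. m i k * v k) = (\<Sum>k\<le>i. a i k * v k)"
      using True by (intro sum.cong) (auto simp: m_def)
    with True rec[of n] show ?thesis by simp
  next
    case False
    have "(\<Sum>k<Suc n. m i k * v k) = (\<Sum>k<Suc (Suc i). m i k * v k)"
      using that False by (intro sum.mono_neutral_right) (auto simp: m_def)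
    also have "\<dots> = (\<Sum>k\<le>i. a i k * v k) - v (Suc i)"
      by (simp add: m_def lessThan_Suc_atMost[symmetric])
    finally show ?thesis using rec[of i] that False by simp
  qed
  have "M * P = Q"
  proof (rule eq_matI)
    fix i j assume "i < dim_row Q" "j < dim_col Q"
    then have ij: "i < Suc n" "j < Suc n" by (simp_all add: Q_def)
    have "(M * P) $$ (i, j)
        = (\<Sum>k<Suc n. m i k * (if j = 0 then v k else if k = j then 1 else 0))"
      using ij by (simp add: M_def P_def scalar_prod_def atLeast0LessThan)
    also have "\<dots> = Q $$ (i, j)"
    proof (cases "j = 0")
      case True
      then show ?thesis using ij col0[of i] by (simp add: Q_def del: sum.lessThan_Suc)
    next
      case False
      then have "(\<Sum>k<Suc n. m i k * (if j = 0 then v k else if k = j then 1 else 0))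
          = (\<Sum>k<Suc n. if k = j then m i k else 0)"
        by (intro sum.cong) auto
      then show ?thesis using ij False by (simp add: Q_def del: sum.lessThan_Suc)
    qed
    finally show "(M * P) $$ (i, j) = Q $$ (i, j)" .
  qed (simp_all add: M_def P_def Q_def)
  then have "det Q = det M * det P"
    using det_mult[OF MC PC] by simp
  also have "det P = 1"
  proof -
    have "det P = prod_list (diag_mat P)"
      by (rule det_lower_triangular[OF _ PC]) (auto simp: P_def)
    also have "\<dots> = (\<Prod>i\<in>{0..<Suc n}. 1)"
      unfolding prod_list_diag_prod by (intro prod.cong) (auto simp: P_def v0)
    finally show ?thesis by simp
  qed
  finally have detM: "det M = det Q" by simp
  have minor: "det (mat_delete Q n 0) = (- 1) ^ n"
  proof -
    have C: "mat_delete Q n 0 \<in> carrier_mat n n"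
      using mat_delete_carrier[OF QC] by simp
    have entry: "mat_delete Q n 0 $$ (i, j) = m i (Suc j)" if "i < n" "j < n" for i j
      using that by (simp add: mat_delete_def Q_def)
    have "det (mat_delete Q n 0) = prod_list (diag_mat (mat_delete Q n 0))"
      by (rule det_lower_triangular[OF _ C]) (simp add: entry m_def)
    also have "\<dots> = (\<Prod>i\<in>{0..<n}. - 1)"
      unfolding prod_list_diag_prod
      by (rule prod.cong) (use C in \<open>auto simp: entry m_def\<close>)
    finally show ?thesis by simp
  qed
  have "det Q = (\<Sum>i<Suc n. Q $$ (i, 0) * cofactor Q i 0)"
    by (rule laplace_expansion_column[OF QC]) simp
  also have "\<dots> = v (Suc n) * cofactor Q n 0"
    by (simp add: Q_def)
  also have "\<dots> = v (Suc n) * ((- 1) ^ n * (- 1) ^ n)"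
    by (simp add: cofactor_def minor)
  also have "\<dots> = v (Suc n)"
    by (simp flip: power_mult_distrib)
  finally show ?thesis using detM by (simp add: M_def m_def)
qed

section \<open>Signed permutations as words\<close>

text \<open>
  A signed permutation is odd, hence determined by its values at \<open>1, \<dots>, n\<close>.  As a list of
  these values it admits the insertion and the removal of a letter.
\<close>
definition signed_words :: "nat \<Rightarrow> int list set" where
  "signed_words n = {xs. distinct (map abs xs) \<and> abs ` set xs = {1..int n}}"

lemma length_signed_word:
  assumes "xs \<in> signed_words n"
  shows "length xs = n"
proof -
  have "length xs = card (set (map abs xs))"
    using assms distinct_card[of "map abs xs"] by (simp add: signed_words_def)
  with assms show ?thesis by (simp add: signed_words_def)
qed

lemma abs_nth_signed_word:
  assumes "xs \<in> signed_words n" "i < n"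
  shows "1 \<le> \<bar>xs ! i\<bar>" "\<bar>xs ! i\<bar> \<le> int n"
proof -
  have "\<bar>xs ! i\<bar> \<in> abs ` set xs"
    using assms length_signed_word[OF assms(1)] by simp
  then have "\<bar>xs ! i\<bar> \<in> {1..int n}"
    using assms(1) unfolding signed_words_def by blast
  then show "1 \<le> \<bar>xs ! i\<bar>" "\<bar>xs ! i\<bar> \<le> int n" by auto
qed

definition word_of :: "nat \<Rightarrow> (int \<Rightarrow> int) \<Rightarrow> int list" where
  "word_of n \<sigma> = map (\<lambda>i. \<sigma> (int (Suc i))) [0..<n]"

definition perm_of :: "nat \<Rightarrow> int list \<Rightarrow> int \<Rightarrow> int" where
  "perm_of n xs i =
     (if 1 \<le> \<bar>i\<bar> \<and> \<bar>i\<bar> \<le> int n then sgn i * xs ! (nat \<bar>i\<bar> - 1) else i)"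

text \<open>
  Equal absolute values mean \<open>\<sigma> i = \<sigma> j\<close> or \<open>\<sigma> i = \<sigma> (-j)\<close>; the signs of the arguments
  exclude \<open>i = -j\<close>.
\<close>
lemma signed_perm_abs_inj:
  assumes "\<sigma> \<in> signed_perms n" "i > 0" "j > 0" "\<bar>\<sigma> i\<bar> = \<bar>\<sigma> j\<bar>"
  shows "i = j"
proof -
  have inj: "\<sigma> k = \<sigma> l \<longleftrightarrow> k = l" for k l
    using assms(1) by (simp add: signed_perms_def permutes_def) metis
  have odd: "\<sigma> (- k) = - \<sigma> k" for k
    using assms(1) by (simp add: signed_perms_def)
  from assms(4) have "\<sigma> i = \<sigma> j \<or> \<sigma> i = \<sigma> (- j)"
    unfolding odd by linarith
  then show ?thesis using assms(2,3) by (simp add: inj)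
qed

lemma word_of_signed_perm:
  assumes "\<sigma> \<in> signed_perms n"
  shows "word_of n \<sigma> \<in> signed_words n"
proof -
  let ?S = "{i. 1 \<le> \<bar>i\<bar> \<and> \<bar>i\<bar> \<le> int n}"
  have perm: "\<sigma> permutes ?S" using assms by (simp add: signed_perms_def)
  have dist: "distinct (map abs (word_of n \<sigma>))"
    using signed_perm_abs_inj[OF assms]
    by (force simp: word_of_def distinct_map inj_on_def)
  have "abs ` set (word_of n \<sigma>) \<subseteq> {1..int n}"
    using permutes_in_image[OF perm] by (auto simp: word_of_def)
  moreover have "card (abs ` set (word_of n \<sigma>)) = card {1..int n}"
    using distinct_card[OF dist] unfolding set_map by (simp add: word_of_def)
  ultimately have "abs ` set (word_of n \<sigma>) = {1..int n}"
    by (intro card_subset_eq) auto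
  with dist show ?thesis by (simp add: signed_words_def)
qed

lemma perm_of_signed_word:
  assumes "xs \<in> signed_words n"
  shows "perm_of n xs \<in> signed_perms n"
proof -
  let ?S = "{i. 1 \<le> \<bar>i\<bar> \<and> \<bar>i\<bar> \<le> int n}"
  have fin: "finite ?S"
    by (rule finite_subset[of _ "{- int n..int n}"]) auto
  have range: "perm_of n xs i \<in> ?S" if "i \<in> ?S" for i
  proof -
    have "nat \<bar>i\<bar> - 1 < n" using that by auto
    from abs_nth_signed_word[OF assms this] show ?thesis
      using that by (auto simp: perm_of_def abs_mult)
  qed
  have nth_inj: "p = q" if "p < n" "q < n" "\<bar>xs ! p\<bar> = \<bar>xs ! q\<bar>" for p q
    using assms that length_signed_word[OF assms]
      nth_eq_iff_index_eq[of "map abs xs" p q] by (simp add: signed_words_def)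
  have inj: "inj_on (perm_of n xs) ?S"
  proof (rule inj_onI)
    fix i j assume i: "i \<in> ?S" and j: "j \<in> ?S" and eq: "perm_of n xs i = perm_of n xs j"
    have nz: "i \<noteq> 0" "j \<noteq> 0" using i j by auto
    have lt: "nat \<bar>i\<bar> - 1 < n" "nat \<bar>j\<bar> - 1 < n" using i j by auto
    have eq': "sgn i * xs ! (nat \<bar>i\<bar> - 1) = sgn j * xs ! (nat \<bar>j\<bar> - 1)"
      using eq i j by (simp add: perm_of_def)
    then have "\<bar>sgn i * xs ! (nat \<bar>i\<bar> - 1)\<bar> = \<bar>sgn j * xs ! (nat \<bar>j\<bar> - 1)\<bar>" by simp
    then have "\<bar>xs ! (nat \<bar>i\<bar> - 1)\<bar> = \<bar>xs ! (nat \<bar>j\<bar> - 1)\<bar>"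
      using nz by (simp add: abs_mult abs_sgn_eq)
    then have pq: "nat \<bar>i\<bar> - 1 = nat \<bar>j\<bar> - 1" using nth_inj lt by blast
    then have ij: "\<bar>i\<bar> = \<bar>j\<bar>" using nz by linarith
    have "sgn i = sgn j"
      using eq' pq abs_nth_signed_word(1)[OF assms lt(2)] by auto
    with ij show "i = j" by (metis abs_mult_sgn mult.commute)
  qed
  have "bij_betw (perm_of n xs) ?S ?S"
    using endo_inj_surj[OF fin _ inj] range inj by (auto simp: bij_betw_def)
  then have "perm_of n xs permutes ?S"
    by (rule bij_imp_permutes) (auto simp: perm_of_def)
  then show ?thesis by (auto simp: signed_perms_def perm_of_def)
qed

lemma bij_betw_word_of: "bij_betw (word_of n) (signed_perms n) (signed_words n)"
proof (rule bij_betw_byWitness[where f' = "perm_of n"])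
  show "\<forall>\<sigma>\<in>signed_perms n. perm_of n (word_of n \<sigma>) = \<sigma>"
  proof (intro ballI ext)
    fix \<sigma> i assume \<sigma>: "\<sigma> \<in> signed_perms n"
    show "perm_of n (word_of n \<sigma>) i = \<sigma> i"
    proof (cases "1 \<le> \<bar>i\<bar> \<and> \<bar>i\<bar> \<le> int n")
      case True
      have odd: "\<sigma> (- k) = - \<sigma> k" for k
        using \<sigma> by (simp add: signed_perms_def)
      have "nat \<bar>i\<bar> - 1 < n" "int (Suc (nat \<bar>i\<bar> - 1)) = \<bar>i\<bar>"
        using True by linarith+
      then have "word_of n \<sigma> ! (nat \<bar>i\<bar> - 1) = \<sigma> \<bar>i\<bar>"
        by (simp add: word_of_def del: of_nat_Suc)
      then have "perm_of n (word_of n \<sigma>) i = sgn i * \<sigma> \<bar>i\<bar>"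
        using True by (simp add: perm_of_def)
      then show ?thesis
        using True odd[of i] by (cases "i > 0") (auto simp: sgn_if)
    next
      case False
      then have "\<sigma> i = i" using \<sigma> by (simp add: signed_perms_def permutes_def)
      then show ?thesis using False by (auto simp: perm_of_def)
    qed
  qed
  show "\<forall>xs\<in>signed_words n. word_of n (perm_of n xs) = xs"
    by (auto simp: word_of_def perm_of_def length_signed_word nat_add_distrib
        intro!: nth_equalityI)
qed (use word_of_signed_perm perm_of_signed_word in blast)+

text \<open>
  The letter before the word is a separate argument because induction on the word changes it;
  at the start it is the value 0 that a signed permutation takes at 0.
\<close>
fun descents_after :: "int \<Rightarrow> int list \<Rightarrow> nat" where
  "descents_after a [] = 0"
| "descents_after a (b # bs) = of_bool (b < a) + descents_after b bs"

lemma descents_after_conv_sum: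
  "descents_after a xs = (\<Sum>i<length xs. of_bool ((a # xs) ! i > xs ! i))"
  by (induction xs arbitrary: a) (simp_all add: sum.lessThan_Suc_shift del: sum.lessThan_Suc)

lemma desB_conv_descents_after:
  assumes "\<sigma> \<in> signed_perms n"
  shows "desB n \<sigma> = descents_after 0 (word_of n \<sigma>)"
proof -
  have "\<sigma> 0 = 0"
    using assms by (simp add: signed_perms_def permutes_def)
  then have nth: "(0 # word_of n \<sigma>) ! i = \<sigma> (int i)" if "i < n" for i
    using that by (cases i) (simp_all add: word_of_def)
  have "descents_after 0 (word_of n \<sigma>)
      = (\<Sum>i<n. of_bool ((0 # word_of n \<sigma>) ! i > word_of n \<sigma> ! i))"
    by (simp add: descents_after_conv_sum word_of_def)
  also have "\<dots> = (\<Sum>i<n. of_bool (\<sigma> (int i) > \<sigma> (int i + 1)))"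
  proof (rule sum.cong[OF refl])
    fix i assume "i \<in> {..<n}"
    then have "word_of n \<sigma> ! i = \<sigma> (int i + 1)"
      by (simp add: word_of_def add.commute)
    with nth \<open>i \<in> {..<n}\<close>
    show "of_bool ((0 # word_of n \<sigma>) ! i > word_of n \<sigma> ! i) = of_bool (\<sigma> (int i) > \<sigma> (int i + 1))"
      by simp
  qed
  also have "\<dots> = desB n \<sigma>"
    by (simp add: desB_def sum_of_bool_eq Int_def atLeast0LessThan)
  finally show ?thesis by simp
qed

lemma eulerianB_conv_words:
  "eulerianB n = (\<Sum>w\<in>signed_words n. monom 1 (descents_after 0 w))"
proof -
  have "eulerianB n = (\<Sum>\<sigma>\<in>signed_perms n. monom 1 (descents_after 0 (word_of n \<sigma>)))"
    by (simp add: eulerianB_def desB_conv_descents_after)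
  also have "\<dots> = (\<Sum>w\<in>signed_words n. monom 1 (descents_after 0 w))"
    by (rule sum.reindex_bij_betw[OF bij_betw_word_of])
  finally show ?thesis .
qed

section \<open>The recurrence of the type B Eulerian polynomials\<close>

text \<open>
  In a word of length \<open>n\<close> with \<open>d\<close> descents, inserting \<open>N\<close> or \<open>-N\<close> into a descent keeps the
  number of descents, and inserting either into an ascent adds one descent.  At the end of the
  word \<open>N\<close> adds no descent and \<open>-N\<close> adds one.  So \<open>2d + 1\<close> of the insertions keep \<open>d\<close>, and
  the other \<open>2(n - d) + 1\<close> raise it by one.
\<close>
lemma sum_insertions:
  fixes N a :: int
  assumes "\<bar>a\<bar> < N" "\<forall>b\<in>set w. \<bar>b\<bar> < N"
  defines "d \<equiv> descents_after a w"
  shows "(\<Sum>p\<le>length w. \<Sum>y\<in>{N, - N}. monom (1 :: real) (descents_after a (take p w @ y # drop p w)))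
       = monom (2 * real d + 1) d + monom (2 * real (length w) - 2 * real d + 1) (Suc d)"
  unfolding d_def using assms(1,2)
proof (induction w arbitrary: a)
  case Nil
  then have "N \<noteq> - N" "\<not> N < a" "- N < a" by auto
  then show ?case by (simp add: add.commute)
next
  case (Cons b bs)
  define c where "c = (of_bool (b < a) :: nat)"
  define e where "e = descents_after b bs"
  let ?n = "real (length bs)"
  have N: "N \<noteq> - N" "\<bar>b\<bar> < N" using Cons.prems by auto
  \<comment> \<open>In front of \<open>b\<close> there is exactly one descent next to the new letter, whatever its sign
    and whatever the comparison of \<open>a\<close> with \<open>b\<close>.\<close>
  have ends: "(\<Sum>y\<in>{N, - N}. monom (1 :: real) (descents_after a (y # b # bs)))
      = monom 2 (Suc e)"
  proof -
    have "b < N" "\<not> N < a" "\<not> b < - N" "- N < a"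
      using Cons.prems N by (auto simp: abs_less_iff)
    then show ?thesis using N by (simp add: e_def add_monom)
  qed
  have "(\<Sum>p\<le>length (b # bs). \<Sum>y\<in>{N, - N}.
          monom (1 :: real) (descents_after a (take p (b # bs) @ y # drop p (b # bs))))
      = monom 2 (Suc e) + (\<Sum>p\<le>length bs. \<Sum>y\<in>{N, - N}.
          monom 1 c * monom (1 :: real) (descents_after b (take p bs @ y # drop p bs)))"
    using ends by (simp add: sum.atMost_Suc_shift mult_monom c_def del: sum.atMost_Suc sum.insert)
  also have "\<dots> = monom 2 (Suc e) + monom 1 c *
      (monom (2 * real e + 1) e + monom (2 * ?n - 2 * real e + 1) (Suc e))"
    using Cons.IH[of b] Cons.prems by (simp add: e_def sum_distrib_left[symmetric])
  also have "\<dots> = monom (2 * real (c + e) + 1) (c + e)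
      + monom (2 * real (length (b # bs)) - 2 * real (c + e) + 1) (Suc (c + e))"
  proof (cases "b < a")
    case True
    then have "c = 1" by (simp add: c_def)
    then show ?thesis by (simp add: mult_monom add_monom distrib_left add.assoc[symmetric])
  next
    case False
    then have "c = 0" by (simp add: c_def)
    then show ?thesis by (simp add: mult_monom add_monom distrib_left add.left_commute)
  qed
  finally show ?case by (simp add: c_def e_def)
qed

definition insert_letter :: "'a list \<times> nat \<times> 'a \<Rightarrow> 'a list" where
  "insert_letter = (\<lambda>(w, p, y). take p w @ y # drop p w)"

text \<open>
  A signed word of size \<open>n+1\<close> has exactly one letter of absolute value \<open>n+1\<close>, and deleting it
  undoes the insertion.
\<close>
lemma bij_betw_insert_letter:
  fixes n :: nat
  defines "N \<equiv> int (Suc n)"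
  shows "bij_betw insert_letter (signed_words n \<times> {..n} \<times> {N, - N}) (signed_words (Suc n))"
proof -
  let ?small = "\<lambda>x :: int. \<bar>x\<bar> \<noteq> N"
  define remove where "remove = (\<lambda>v. (filter ?small v, length (takeWhile ?small v),
    v ! length (takeWhile ?small v)))"
  have small: "?small x" if "w \<in> signed_words n" "x \<in> set w" for w x
  proof -
    have "\<bar>x\<bar> \<in> {1..int n}" using that unfolding signed_words_def by blast
    then show ?thesis by (simp add: N_def)
  qed
  have Icc: "{1..int (Suc n)} = insert N {1..int n}" by (auto simp: N_def)
  have decompose: "\<exists>us y vs. v = us @ y # vs \<and> \<bar>y\<bar> = N \<and>
      (\<forall>x\<in>set us \<union> set vs. ?small x) \<and> us @ vs \<in> signed_words n"
    if v: "v \<in> signed_words (Suc n)" for v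
  proof -
    have "N \<in> abs ` set v" using v unfolding signed_words_def by (auto simp: N_def)
    then obtain y where y: "y \<in> set v" "\<bar>y\<bar> = N" by auto
    then obtain us vs where uv: "v = us @ y # vs" by (meson split_list)
    have dist: "distinct (map abs (us @ vs))" and N: "N \<notin> abs ` set (us @ vs)"
      using v y uv by (auto simp: signed_words_def)
    have "insert N (abs ` set (us @ vs)) = insert N {1..int n}"
      using v y uv unfolding signed_words_def Icc by auto
    then have "abs ` set (us @ vs) = {1..int n}"
      using N insert_ident[of N _ "{1..int n}"] by (simp add: N_def)
    then have "us @ vs \<in> signed_words n" using dist by (simp add: signed_words_def)
    moreover have "\<forall>x\<in>set us \<union> set vs. ?small x" using N by auto
    ultimately show ?thesis using uv y by blast
  qed
  have remove_append: "remove (us @ y # vs) = (us @ vs, length us, y)"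
    if "\<bar>y\<bar> = N" "\<forall>x\<in>set us \<union> set vs. ?small x" for us y vs
  proof -
    have "takeWhile ?small (us @ y # vs) = us"
      using that by (simp add: takeWhile_append2)
    moreover have "filter ?small us = us" "filter ?small vs = vs"
      using that by (simp_all add: filter_id_conv)
    ultimately show ?thesis using that by (simp add: remove_def)
  qed
  show ?thesis
  proof (rule bij_betw_byWitness[where f' = remove])
    show "\<forall>t\<in>signed_words n \<times> {..n} \<times> {N, - N}. remove (insert_letter t) = t"
    proof
      fix t assume "t \<in> signed_words n \<times> {..n} \<times> {N, - N}"
      then obtain w p y where t: "t = (w, p, y)" "w \<in> signed_words n" "p \<le> n" "\<bar>y\<bar> = N"
        by (auto simp: N_def)
      have "\<forall>x\<in>set (take p w) \<union> set (drop p w). ?small x"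
        using small[OF t(2)] by (auto dest: in_set_takeD in_set_dropD)
      from remove_append[OF t(4) this] show "remove (insert_letter t) = t"
        using t length_signed_word[OF t(2)] by (simp add: insert_letter_def)
    qed
    show "\<forall>v\<in>signed_words (Suc n). insert_letter (remove v) = v"
      using decompose remove_append by (fastforce simp: insert_letter_def)
    show "insert_letter ` (signed_words n \<times> {..n} \<times> {N, - N}) \<subseteq> signed_words (Suc n)"
    proof
      fix v assume "v \<in> insert_letter ` (signed_words n \<times> {..n} \<times> {N, - N})"
      then obtain w p y where v: "v = take p w @ y # drop p w"
        and w: "w \<in> signed_words n" and y: "\<bar>y\<bar> = N"
        by (auto simp: insert_letter_def N_def)
      have N: "N \<notin> abs ` set w" using small[OF w] by auto
      have set_v: "set v = insert y (set w)"
        unfolding v by (metis append_take_drop_id list.set(2) set_append Un_insert_right)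
      have "mset (map abs v) = mset (map abs (y # w))"
        unfolding v by (metis append_take_drop_id mset_append mset_map mset.simps(2)
          union_mset_add_mset_right)
      then have "distinct (map abs v) = distinct (map abs (y # w))"
        by (rule mset_eq_imp_distinct_iff)
      then have "distinct (map abs v)" using w y N by (simp add: signed_words_def)
      moreover have "abs ` set v = {1..int (Suc n)}"
        using w y unfolding set_v Icc by (simp add: signed_words_def)
      ultimately show "v \<in> signed_words (Suc n)" by (simp add: signed_words_def)
    qed
    show "remove ` signed_words (Suc n) \<subseteq> signed_words n \<times> {..n} \<times> {N, - N}"
    proof
      fix t assume "t \<in> remove ` signed_words (Suc n)"
      then obtain v where v: "v \<in> signed_words (Suc n)" "t = remove v" by blast
      from decompose[OF v(1)] obtain us y vs where d: "v = us @ y # vs" "\<bar>y\<bar> = N"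
        "\<forall>x\<in>set us \<union> set vs. ?small x" "us @ vs \<in> signed_words n" by blast
      then have "length us \<le> n" using length_signed_word[OF d(4)] by simp
      with d v remove_append[OF d(2,3)] show "t \<in> signed_words n \<times> {..n} \<times> {N, - N}"
        by auto
    qed
  qed
qed

lemma pderiv_sum: "pderiv (sum f A) = (\<Sum>i\<in>A. pderiv (f i))"
  using higher_pderiv_sum[of 1 f A] by simp

lemma eulerianB_0: "eulerianB 0 = 1"
proof -
  have "signed_words 0 = {[]}" by (auto simp: signed_words_def)
  then show ?thesis by (simp add: eulerianB_conv_words)
qed

text \<open>
  The weight \<open>d\<close> in \<open>sum_insertions\<close> is what \<open>x d/dx\<close> produces from \<open>x\<^sup>d\<close>, so the sum over
  all insertions is a first-order differential operator that depends only on \<open>n\<close>.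
\<close>
lemma eulerianB_Suc:
  "eulerianB (Suc n) =
     [:1, 2 * real n + 1:] * eulerianB n + [:0, 2, - 2:] * pderiv (eulerianB n)"
proof -
  let ?N = "int (Suc n)"
  let ?X = "\<lambda>w. monom (1 :: real) (descents_after 0 w)"
  have "eulerianB (Suc n)
      = (\<Sum>t\<in>signed_words n \<times> {..n} \<times> {?N, - ?N}. ?X (insert_letter t))"
    unfolding eulerianB_conv_words
    by (rule sum.reindex_bij_betw[OF bij_betw_insert_letter, symmetric])
  also have "\<dots> = (\<Sum>w\<in>signed_words n. \<Sum>p\<le>n. \<Sum>y\<in>{?N, - ?N}.
      ?X (take p w @ y # drop p w))"
    unfolding sum.cartesian_product by (intro sum.cong) (auto simp: insert_letter_def)
  also have "\<dots> = (\<Sum>w\<in>signed_words n. [:1, 2 * real n + 1:] * ?X w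
      + [:0, 2, - 2:] * pderiv (?X w))"
  proof (rule sum.cong[OF refl])
    fix w assume w: "w \<in> signed_words n"
    let ?d = "descents_after 0 w"
    have len: "length w = n" by (rule length_signed_word[OF w])
    have "\<forall>b\<in>set w. \<bar>b\<bar> < ?N"
      using abs_nth_signed_word[OF w] len by (fastforce simp: in_set_conv_nth)
    then have "(\<Sum>p\<le>n. \<Sum>y\<in>{?N, - ?N}. ?X (take p w @ y # drop p w))
        = monom (2 * real ?d + 1) ?d + monom (2 * real n - 2 * real ?d + 1) (Suc ?d)"
      using sum_insertions[of 0 ?N w] unfolding len by simp
    also have "\<dots> = [:1, 2 * real n + 1:] * ?X w + [:0, 2, - 2:] * pderiv (?X w)"
    proof -
      have as_monoms: "[:1, 2 * real n + 1:] = monom 1 0 + monom (2 * real n + 1) 1"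
        "[:0, 2, - 2 :: real:] = monom 2 1 + monom (- 2) 2"
        by (simp_all add: monom_altdef numeral_2_eq_2)
      then show ?thesis
        unfolding as_monoms distrib_right mult_monom pderiv_monom
        by (cases ?d) (auto simp: poly_eq_iff algebra_simps)
    qed
    finally show "(\<Sum>p\<le>n. \<Sum>y\<in>{?N, - ?N}. ?X (take p w @ y # drop p w)) = \<dots>" .
  qed
  also have "\<dots> = [:1, 2 * real n + 1:] * eulerianB n
      + [:0, 2, - 2:] * pderiv (eulerianB n)"
    unfolding eulerianB_conv_words
    by (simp only: sum.distrib sum_distrib_left pderiv_sum)
  finally show ?thesis .
qed

section \<open>The convolution identity\<close>

text \<open>
  This is \<open>x d/dx\<close> acting on \<open>p / (1 - x\<^sup>2)\<^sup>m\<close>, read off on the numerator over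
  \<open>(1 - x\<^sup>2)\<^bsup>m+1\<^esup>\<close>.
\<close>
definition numer_deriv :: "nat \<Rightarrow> real poly \<Rightarrow> real poly" where
  "numer_deriv m p = of_nat m * [:0, 0, 2:] * p + [:0, 1, 0, -1:] * pderiv p"

text \<open>
  Leibniz' rule for \<open>x d/dx\<close>; the exponents of \<open>1 - x\<^sup>2\<close> in the denominators add up.
\<close>
lemma numer_deriv_mult:
  "numer_deriv (k + l) (p * q) = numer_deriv k p * q + p * numer_deriv l q"
  by (simp only: numer_deriv_def pderiv_mult of_nat_add algebra_simps)

lemma numer_deriv_sum: "numer_deriv m (sum f A) = (\<Sum>i\<in>A. numer_deriv m (f i))"
  by (simp only: numer_deriv_def sum.distrib sum_distrib_left pderiv_sum)

lemma numer_deriv_of_nat_mult: "numer_deriv m (of_nat c * p) = of_nat c * numer_deriv m p"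
  by (simp add: numer_deriv_def pderiv_mult algebra_simps)

definition alt_run_reflected :: "nat \<Rightarrow> real poly" where
  "alt_run_reflected n = pcompose (alt_run_poly n) [:0, -1:]"

text \<open>
  The extra summand comes from \<open>x r' = r x / (1 - x\<^sup>2)\<close>.  It changes sign for \<open>1 / r\<close> in the
  reflected recurrence, which makes it cancel in products.
\<close>
lemma alt_run_poly_Suc_numer_deriv:
  "alt_run_poly (Suc n) = numer_deriv n (alt_run_poly n) + [:0, 1:] * alt_run_poly n"
proof -
  have "[:0, 1, 2 * of_nat n:] = of_nat n * [:0, 0, 2:] + [:0, 1 :: real:]"
    by (simp add: of_nat_poly)
  then show ?thesis by (simp only: alt_run_poly_Suc numer_deriv_def algebra_simps)
qed

lemma alt_run_reflected_Suc:
  "alt_run_reflected (Suc n)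
     = numer_deriv n (alt_run_reflected n) - [:0, 1:] * alt_run_reflected n"
  unfolding alt_run_reflected_def alt_run_poly_Suc_numer_deriv numer_deriv_def
  by (rule poly_eq_poly_eq_iff[THEN iffD1], rule ext)
     (simp add: poly_pcompose pderiv_pcompose pderiv_pCons algebra_simps)

text \<open>
  Up to a power of \<open>1 - x\<^sup>2\<close>, \<open>S n\<close> is the Leibniz expansion of the \<open>n\<close>-th derivative of
  \<open>D r \<cdot> (1 / r)\<close>, with \<open>D = x d/dx\<close>; differentiating it once more raises one of the two
  indices in each term, and Pascal's rule collects the result.
\<close>
lemma alt_run_convolution_Suc:
  defines "S \<equiv> \<lambda>n. \<Sum>k\<le>n. of_nat (n choose k) *
    (alt_run_poly (Suc k) * alt_run_reflected (n - k))"
  shows "S (Suc n) = numer_deriv (Suc n) (S n)"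
proof -
  let ?F = alt_run_poly and ?G = alt_run_reflected
  have step: "numer_deriv (Suc n) (?F (Suc k) * ?G (n - k))
      = ?F (Suc (Suc k)) * ?G (n - k) + ?F (Suc k) * ?G (Suc n - k)" if "k \<le> n" for k
  proof -
    have "numer_deriv (Suc n) (?F (Suc k) * ?G (n - k))
        = numer_deriv (Suc k) (?F (Suc k)) * ?G (n - k)
          + ?F (Suc k) * numer_deriv (n - k) (?G (n - k))"
      using numer_deriv_mult[of "Suc k" "n - k"] that by simp
    also have "numer_deriv (Suc k) (?F (Suc k)) = ?F (Suc (Suc k)) - [:0, 1:] * ?F (Suc k)"
      by (simp only: alt_run_poly_Suc_numer_deriv[of "Suc k"] add_diff_cancel_right')
    also have "numer_deriv (n - k) (?G (n - k)) = ?G (Suc (n - k)) + [:0, 1:] * ?G (n - k)"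
      by (simp only: alt_run_reflected_Suc diff_add_cancel)
    finally show ?thesis using that by (simp only: Suc_diff_le algebra_simps)
  qed
  have "S (Suc n) = ?F 1 * ?G (Suc n)
      + (\<Sum>k\<le>n. of_nat (Suc n choose Suc k) * (?F (Suc (Suc k)) * ?G (n - k)))"
    unfolding S_def by (simp add: sum.atMost_Suc_shift del: sum.atMost_Suc)
  also have "\<dots> = (\<Sum>k\<le>n. of_nat (n choose k) * (?F (Suc (Suc k)) * ?G (n - k)))
      + (?F 1 * ?G (Suc n)
        + (\<Sum>k\<le>n. of_nat (n choose Suc k) * (?F (Suc (Suc k)) * ?G (n - k))))"
    by (simp add: distrib_right sum.distrib)
  also have "?F 1 * ?G (Suc n)
        + (\<Sum>k\<le>n. of_nat (n choose Suc k) * (?F (Suc (Suc k)) * ?G (n - k)))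
      = (\<Sum>k\<le>Suc n. of_nat (n choose k) * (?F (Suc k) * ?G (Suc n - k)))"
    by (simp add: sum.atMost_Suc_shift del: sum.atMost_Suc)
  also have "\<dots> = (\<Sum>k\<le>n. of_nat (n choose k) * (?F (Suc k) * ?G (Suc n - k)))"
    by simp
  also have "(\<Sum>k\<le>n. of_nat (n choose k) * (?F (Suc (Suc k)) * ?G (n - k)))
      + (\<Sum>k\<le>n. of_nat (n choose k) * (?F (Suc k) * ?G (Suc n - k)))
      = numer_deriv (Suc n) (S n)"
    by (simp add: S_def numer_deriv_sum numer_deriv_of_nat_mult step distrib_left sum.distrib)
  finally show ?thesis .
qed

text \<open>
  Substituting \<open>x\<^sup>2\<close> turns \<open>2 t d/dt\<close> into \<open>x d/dx\<close>, and the factor \<open>x\<close> accounts for the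
  remaining terms of \<open>eulerianB_Suc\<close>.
\<close>
lemma eulerianB_odd_Suc:
  fixes n :: nat
  defines "E \<equiv> \<lambda>n. [:0, 1:] * pcompose (eulerianB n) (monom 1 2)"
  shows "E (Suc n) = numer_deriv (Suc n) (E n)"
  unfolding E_def numer_deriv_def eulerianB_Suc
  by (rule poly_eq_poly_eq_iff[THEN iffD1], rule ext)
     (simp add: poly_pcompose pderiv_pcompose pderiv_mult pderiv_pCons pderiv_monom
       poly_monom algebra_simps power2_eq_square)

lemma alt_run_convolution:
  "(\<Sum>k\<le>n. of_nat (n choose k) * (alt_run_poly (Suc k) * alt_run_reflected (n - k)))
     = [:0, 1:] * pcompose (eulerianB n) (monom 1 2)"
proof (induction n)
  case 0
  show ?case
    by (simp add: alt_run_poly_Suc alt_run_reflected_def alt_run_poly_0 eulerianB_0 pcompose_1)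
next
  case (Suc n)
  then show ?case by (simp only: alt_run_convolution_Suc eulerianB_odd_Suc)
qed

section \<open>The determinant\<close>

text \<open>
  The convolution identity solved for its term \<open>k = i\<close>.  Column 0 carries
  \<open>x B\<^sub>i (x\<^sup>2)\<close> with coefficient \<open>F\<^sub>0 = 1\<close>, which is why the binomial index of the other columns
  is shifted by one.
\<close>
lemma alt_run_poly_hessenberg_recurrence:
  "alt_run_poly (Suc i) = (\<Sum>j\<le>i. hess_entry i j * alt_run_poly j)"
proof (cases i)
  case 0
  then show ?thesis by (simp add: hess_entry_def alt_run_poly_Suc alt_run_poly_0)
next
  case (Suc m)
  let ?t = "\<lambda>k. of_nat (i choose k) * (alt_run_poly (Suc k) * alt_run_reflected (i - k))"
  have "(\<Sum>j\<le>i. hess_entry i j * alt_run_poly j) = [:0, 1:] * pcompose (eulerianB i) (monom 1 2)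
      + (\<Sum>k\<le>m. hess_entry i (Suc k) * alt_run_poly (Suc k))"
    unfolding Suc sum.atMost_Suc_shift by (simp add: hess_entry_def alt_run_poly_0)
  also have "(\<Sum>k\<le>m. hess_entry i (Suc k) * alt_run_poly (Suc k)) = - (\<Sum>k\<le>m. ?t k)"
    unfolding sum_negf[symmetric]
    by (rule sum.cong)
      (auto simp: Suc hess_entry_def alt_run_reflected_def Suc_diff_le algebra_simps)
  also have "[:0, 1:] * pcompose (eulerianB i) (monom 1 2) = (\<Sum>k\<le>m. ?t k) + ?t i"
    using alt_run_convolution[of i] by (simp add: Suc)
  also have "?t i = alt_run_poly (Suc i)"
    by (simp add: alt_run_reflected_def alt_run_poly_0 pcompose_1)
  finally show ?thesis by simp
qed

theorem theorem21:
  fixes n :: nat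
  assumes "n \<ge> 1"
  shows "alt_run_poly (n + 1) = det (mat (n + 1) (n + 1) (\<lambda>(i, j). hess_entry i j))"
proof -
  have "hess_entry i j = (if j \<le> i then hess_entry i j else if j = Suc i then - 1 else 0)"
    for i j by (simp add: hess_entry_def)
  then have "mat (n + 1) (n + 1) (\<lambda>(i, j). hess_entry i j) = mat (Suc n) (Suc n)
      (\<lambda>(i, j). if j \<le> i then hess_entry i j else if j = Suc i then - 1 else 0)"
    by (intro cong_mat) auto
  then show ?thesis
    using det_lower_hessenberg[of alt_run_poly n hess_entry]
    by (simp add: alt_run_poly_0 alt_run_poly_hessenberg_recurrence)
qed

end
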